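(* Let $\mathcal{X},\mathcal{Y}$ be finite alphabets, let $P_{XY}$ be a probability distribution on $\mathcal{X}\times\mathcal{Y}$ with $\mathcal{X}$-marginal $P_X$, and let $E_0>0$. Put $$R_{\mathrm{w}}^*(E_0)=\min_{\{Q_X:\ D(Q_X\|P_X)\le E_0\}}\mathbf{E}_Q\ln\frac{1}{P_X(X)}-E_0,$$ and define the fixed-rate FR--FA trade-off function $$E_{\mathrm{FR}}^{\mathrm{f}}[E_0]=\min_{Q_{XY}}\left\{D(Q_{XY}\|P_{XY})+[R_{\mathrm{w}}^*(E_0)-H_Q(X|Y)]_+\right\},$$ where the minimum is over all probability distributions $Q_{XY}$ on $\mathcal{X}\times\mathcal{Y}$. Then $$E_{\mathrm{FR}}^{\mathrm{f}}[E_0]=\max_{0\le\rho\le 1}\ \sup_{\lambda\ge 0}\left\{-\ln\left[\sum_{y\in\mathcal{Y}}\left(\sum_{x\in\mathcal{X}}[P_{XY}(x,y)]^{1/(1+\rho)}\right)^{1+\rho}\right]-\rho\lambda\ln\left(\sum_{x\in\mathcal{X}}[P_X(x)]^{1+1/\lambda}\right)-\rho(1+\lambda)E_0\right\}.$$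
   Context: All logarithms are natural and $[t]_+=\max\{0,t\}$. $D(\cdot\|\cdot)$ is the Kullback--Leibler divergence (equal to $+\infty$ when absolute continuity fails), $H_Q(X|Y)$ is the conditional Shannon entropy of $X$ given $Y$ under $Q_{XY}$, and $\mathbf{E}_Q\ln\frac{1}{P_X(X)}=\sum_xQ_X(x)\ln\frac{1}{P_X(x)}$ (with $0\cdot\ln\frac10=0$). In the supremum, the expression $\lambda\ln\left(\sum_x[P_X(x)]^{1+1/\lambda}\right)$ at $\lambda=0$ is understood as its limit as $\lambda\downarrow 0$. Background: $R_{\mathrm{w}}^*(E_0)$ is the largest helper-message rate of a fixed-rate code compatible with a false-accept error exponent of at least $E_0$, and $E_{\mathrm{FR}}^{\mathrm{f}}[E_0]$ is the random-coding false-reject error exponent at that rate under optimal decoding. *)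

theory Defs
  imports "HOL-Probability.Probability"
begin

(* The library's KL_divergence b M N is D(N || M), so the arguments are swapped here; its value
   is meaningful only when N is absolutely continuous with respect to M. *)
definition kl_div :: "'a pmf \<Rightarrow> 'a pmf \<Rightarrow> ereal" where
  "kl_div Q P =
    (if absolutely_continuous (measure_pmf P) (measure_pmf Q)
     then ereal (KL_divergence (exp 1) (measure_pmf P) (measure_pmf Q)) else \<infinity>)"

definition cond_entropy_nats :: "('x \<times> 'y) pmf \<Rightarrow> real" where
  "cond_entropy_nats Q =
    prob_space.conditional_entropy (measure_pmf Q) (exp 1) (count_space UNIV) (count_space UNIV) fst snd"

(* A symbol x with P x = 0 contributes 0.  This is the correct value whenever Q is absolutely
   continuous with respect to P, which the divergence constraint in helper_rate enforces. *)
definition expected_self_information :: "'x pmf \<Rightarrow> 'x pmf \<Rightarrow> real" where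
  "expected_self_information Q P = measure_pmf.expectation Q (\<lambda>x. ln (1 / pmf P x))"

(* R_w^*(E0). *)
definition helper_rate :: "('x \<times> 'y) pmf \<Rightarrow> real \<Rightarrow> real" where
  "helper_rate P E0 =
    (INF Q\<in>{Q. kl_div Q (map_pmf fst P) \<le> ereal E0}. expected_self_information Q (map_pmf fst P)) - E0"

definition fr_objective :: "('x \<times> 'y) pmf \<Rightarrow> real \<Rightarrow> ('x \<times> 'y) pmf \<Rightarrow> ereal" where
  "fr_objective P E0 Q = kl_div Q P + ereal (max 0 (helper_rate P E0 - cond_entropy_nats Q))"

(* E_FR^f[E0]. *)
definition fr_exponent :: "('x \<times> 'y) pmf \<Rightarrow> real \<Rightarrow> ereal" where
  "fr_exponent P E0 = (INF Q. fr_objective P E0 Q)"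

definition scaled_log_power_sum :: "'x::finite pmf \<Rightarrow> real \<Rightarrow> real" where
  "scaled_log_power_sum P l =
    (let g = (\<lambda>t. t * ln (\<Sum>x\<in>UNIV. pmf P x powr (1 + 1 / t)))
     in if l = 0 then Lim (at_right 0) g else g l)"

definition dual_objective :: "('x::finite \<times> 'y::finite) pmf \<Rightarrow> real \<Rightarrow> real \<Rightarrow> real \<Rightarrow> real" where
  "dual_objective P E0 \<rho> l =
    - ln (\<Sum>y\<in>UNIV. (\<Sum>x\<in>UNIV. pmf P (x, y) powr (1 / (1 + \<rho>))) powr (1 + \<rho>))
    - \<rho> * scaled_log_power_sum (map_pmf fst P) l
    - \<rho> * (1 + l) * E0"

definition dual_value :: "('x::finite \<times> 'y::finite) pmf \<Rightarrow> real \<Rightarrow> real \<Rightarrow> ereal" where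
  "dual_value P E0 \<rho> = (SUP l\<in>{0..}. ereal (dual_objective P E0 \<rho> l))"


text \<open>The measure-theoretic notions above reduce to the usual finite sums.\<close>

lemma absolutely_continuous_pmf_iff:
  fixes P Q :: "'a::finite pmf"
  shows "absolutely_continuous (measure_pmf P) (measure_pmf Q) \<longleftrightarrow> (\<forall>x. pmf P x = 0 \<longrightarrow> pmf Q x = 0)"
proof
  assume a: "absolutely_continuous (measure_pmf P) (measure_pmf Q)"
  show "\<forall>x. pmf P x = 0 \<longrightarrow> pmf Q x = 0"
  proof (intro allI impI)
    fix x assume "pmf P x = 0"
    then have "emeasure (measure_pmf P) {x} = 0" by (simp add: emeasure_pmf_single)
    with a have "emeasure (measure_pmf Q) {x} = 0"
      by (auto dest!: absolutely_continuousD[where A="{x}"])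
    then show "pmf Q x = 0" by (simp add: emeasure_pmf_single)
  qed
next
  assume z: "\<forall>x. pmf P x = 0 \<longrightarrow> pmf Q x = 0"
  have "emeasure (measure_pmf Q) A = 0" if "emeasure (measure_pmf P) A = 0" for A
  proof -
    have "set_pmf P \<inter> A = {}"
      using that by (simp add: measure_pmf.emeasure_eq_measure measure_pmf_zero_iff)
    moreover have "set_pmf Q \<subseteq> set_pmf P" using z by (auto simp: set_pmf_iff)
    ultimately have "set_pmf Q \<inter> A = {}" by auto
    then show ?thesis by (simp add: measure_pmf.emeasure_eq_measure measure_pmf_zero_iff)
  qed
  then show "absolutely_continuous (measure_pmf P) (measure_pmf Q)"
    by (auto simp: absolutely_continuous_def null_sets_def)
qed

lemma kl_div_eq_sum:
  fixes P Q :: "'a::finite pmf"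
  shows "kl_div Q P =
    (if \<forall>x. pmf P x = 0 \<longrightarrow> pmf Q x = 0
     then ereal (\<Sum>x\<in>UNIV. pmf Q x * ln (pmf Q x / pmf P x)) else \<infinity>)"
proof -
  have "KL_divergence (exp 1) (measure_pmf P) (measure_pmf Q) =
      (\<Sum>x\<in>UNIV. pmf Q x * ln (pmf Q x / pmf P x))"
    if z: "\<forall>x. pmf P x = 0 \<longrightarrow> pmf Q x = 0"
  proof -
    interpret sigma_finite_measure "count_space (UNIV :: 'a set)"
      by (rule sigma_finite_measure_count_space_finite) simp
    have "KL_divergence (exp 1) (density (count_space UNIV) (\<lambda>x. ennreal (pmf P x)))
        (density (count_space UNIV) (\<lambda>x. ennreal (pmf Q x)))
      = (\<integral>x. pmf Q x * log (exp 1) (pmf Q x / pmf P x) \<partial>count_space UNIV)"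
      by (rule KL_density_density) (use z in auto)
    then show ?thesis
      by (simp add: measure_pmf_eq_density[symmetric] lebesgue_integral_count_space_finite log_def)
  qed
  then show ?thesis by (simp add: kl_div_def absolutely_continuous_pmf_iff)
qed

lemma cond_entropy_nats_eq_sum:
  fixes Q :: "('x::finite \<times> 'y::finite) pmf"
  shows "cond_entropy_nats Q =
    - (\<Sum>(x, y)\<in>UNIV. pmf Q (x, y) * ln (pmf Q (x, y) / pmf (map_pmf snd Q) y))"
proof -
  interpret information_space "measure_pmf Q" "exp 1"
    by unfold_locales simp
  have Y: "simple_distributed (measure_pmf Q) snd (\<lambda>y. pmf (map_pmf snd Q) y)"
    by (rule measure_pmf.simple_distributedI) (auto simp: simple_function_def pmf_map)
  have XY: "simple_distributed (measure_pmf Q) (\<lambda>z. (fst z, snd z)) (pmf Q)"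
  proof (rule measure_pmf.simple_distributedI)
    fix z :: "'x \<times> 'y"
    have "(\<lambda>z. (fst z, snd z)) -` {z} \<inter> space (measure_pmf Q) = {z}" by auto
    then show "pmf Q z = measure (measure_pmf Q) ((\<lambda>z. (fst z, snd z)) -` {z} \<inter> space (measure_pmf Q))"
      by (simp add: measure_pmf_single)
  qed (auto simp: simple_function_def)
  show ?thesis
    using conditional_entropy_eq[OF Y XY] by (simp add: cond_entropy_nats_def log_def)
qed

lemma expected_self_information_eq_sum:
  fixes P Q :: "'x::finite pmf"
  shows "expected_self_information Q P = (\<Sum>x\<in>UNIV. pmf Q x * ln (1 / pmf P x))"
  unfolding expected_self_information_def
  by (subst integral_measure_pmf_real[where A=UNIV]) (auto simp: mult.commute)

end

theory Submission
  imports Defs "HOL-Real_Asymp.Real_Asymp"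
begin

text \<open>
  Both minimisations are solved exactly by exponentially tilted distributions, so neither a
  minimax theorem nor compactness is needed. Weak duality is the log-sum inequality. For the
  helper rate, the tilted laws \<open>q\<^sub>s \<propto> p\<^sup>1\<^sup>+\<^sup>s\<close> with \<open>s = 1 / \<lambda>\<close> move continuously away from \<open>p\<close>, so
  by the intermediate value theorem one of them has divergence exactly \<open>E0\<close>, or else their limit, the
  uniform law on the most likely symbols, is feasible and \<open>\<lambda> = 0\<close> is optimal. For the exponent, let
  \<open>Q\<^sub>\<rho>\<close> minimise \<open>D(Q \<parallel> P) - \<rho> H\<^sub>Q(X|Y)\<close> and let \<open>h(\<rho>)\<close> be the gap \<open>R - H(X|Y)\<close> under
  \<open>Q\<^sub>\<rho>\<close>. By continuity some \<open>\<rho> \<in> [0,1]\<close> is complementary to it, in the sense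
  \<open>[h(\<rho>)]\<^sub>+ = \<rho> h(\<rho>)\<close>, and this \<open>\<rho>\<close> with \<open>Q\<^sub>\<rho>\<close> is a saddle point.
\<close>

section \<open>Log-sum inequality and finite probability mass functions\<close>

text \<open>Follows termwise from \<open>ln t \<le> t - 1\<close>, with \<open>t\<close> the ratio
  of \<open>b i\<close>, rescaled to have the same total as \<open>a\<close>, to \<open>a i\<close>.
  This inequality is the source of both weak duality bounds below.\<close>

lemma log_sum_inequality:
  fixes a b :: "'i \<Rightarrow> real"
  assumes fin: "finite A" and a: "\<And>i. i \<in> A \<Longrightarrow> 0 \<le> a i" and b: "\<And>i. i \<in> A \<Longrightarrow> 0 \<le> b i"
    and ab: "\<And>i. i \<in> A \<Longrightarrow> b i = 0 \<Longrightarrow> a i = 0"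
  shows "sum a A * ln (sum a A / sum b A) \<le> (\<Sum>i\<in>A. a i * ln (a i / b i))"
proof (cases "sum a A = 0")
  case True
  then have "\<And>i. i \<in> A \<Longrightarrow> a i = 0" using fin a by (simp add: sum_nonneg_eq_0_iff)
  then show ?thesis by simp
next
  case False
  then have sa: "sum a A > 0" using a by (simp add: sum_nonneg order_less_le)
  have "sum b A \<noteq> 0"
    using False ab b fin by (metis sum.neutral sum_nonneg_eq_0_iff)
  then have sb: "sum b A > 0" using b by (simp add: sum_nonneg order_less_le)
  \<comment> \<open>The extra term compares \<open>a\<close> with \<open>b\<close> rescaled to the
    same total, so it sums to zero over \<open>A\<close>.\<close>
  have summand_le: "a i * ln (sum a A / sum b A) + (a i - b i * (sum a A / sum b A)) \<le> a i * ln (a i / b i)"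
    if i: "i \<in> A" for i
  proof (cases "a i = 0")
    case True
    then show ?thesis using b[OF i] sa sb by simp
  next
    case False
    then have ai: "a i > 0" using a[OF i] by simp
    then have bi: "b i > 0" using b[OF i] ab[OF i] by fastforce
    define t where "t = b i * (sum a A / sum b A) / a i"
    have t: "t > 0" using ai bi sa sb by (simp add: t_def)
    have "ln t = ln (sum a A / sum b A) - ln (a i / b i)"
      using ai bi sa sb by (simp add: t_def ln_mult_pos ln_divide_pos)
    moreover have "ln t \<le> t - 1" using t by (rule ln_le_minus_one)
    ultimately have "a i * (ln (sum a A / sum b A) - ln (a i / b i)) \<le> a i * (t - 1)"
      using ai by simp
    also have "\<dots> = b i * (sum a A / sum b A) - a i" using ai by (simp add: t_def field_simps)
    finally show ?thesis by (simp add: algebra_simps)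
  qed
  have "(\<Sum>i\<in>A. a i * ln (sum a A / sum b A) + (a i - b i * (sum a A / sum b A)))
      \<le> (\<Sum>i\<in>A. a i * ln (a i / b i))"
    by (rule sum_mono) (rule summand_le)
  moreover have "(\<Sum>i\<in>A. a i * ln (sum a A / sum b A) + (a i - b i * (sum a A / sum b A)))
      = sum a A * ln (sum a A / sum b A)"
    using sb by (simp add: sum.distrib sum_subtractf flip: sum_distrib_right sum_divide_distrib)
  ultimately show ?thesis by simp
qed

text \<open>The endpoint 0 matters: the limit of the tilted laws vanishes at symbols that every
  tilted law charges.\<close>

lemma continuous_on_mult_ln: "continuous_on {0..} (\<lambda>x::real. x * ln x)"
proof (clarsimp simp: continuous_on_eq_continuous_within)
  fix x :: real assume "0 \<le> x"
  show "continuous (at x within {0..}) (\<lambda>x. x * ln x)"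
  proof (cases "x = 0")
    case True
    have "((\<lambda>x::real. x * ln x) \<longlongrightarrow> 0) (at_right 0)" by real_asymp
    then show ?thesis using True
      by (simp add: continuous_within at_within_Ici_at_right)
  next
    case False
    then show ?thesis using \<open>0 \<le> x\<close> by (intro continuous_intros) auto
  qed
qed

definition normalized_pmf :: "('a::finite \<Rightarrow> real) \<Rightarrow> 'a pmf" where
  "normalized_pmf w = embed_pmf (\<lambda>x. w x / sum w UNIV)"

lemma pmf_normalized_pmf:
  assumes "\<And>x. 0 \<le> w x" and "0 < sum w UNIV"
  shows "pmf (normalized_pmf w) x = w x / sum w UNIV"
  unfolding normalized_pmf_def
proof (rule pmf_embed_pmf)
  show "0 \<le> w x / sum w UNIV" for x using assms by simp
  have "(\<integral>\<^sup>+ x. ennreal (w x / sum w UNIV) \<partial>count_space UNIV) = (\<Sum>x\<in>UNIV. ennreal (w x / sum w UNIV))"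
    by (simp add: nn_integral_count_space_finite)
  also have "\<dots> = ennreal (\<Sum>x\<in>UNIV. w x / sum w UNIV)"
    using assms by (intro sum_ennreal) simp
  also have "(\<Sum>x\<in>UNIV. w x / sum w UNIV) = 1"
    using assms by (simp flip: sum_divide_distrib)
  finally show "(\<integral>\<^sup>+ x. ennreal (w x / sum w UNIV) \<partial>count_space UNIV) = 1" by simp
qed

lemma sum_pmf_UNIV: "sum (pmf (p :: 'a::finite pmf)) UNIV = 1"
  by (rule sum_pmf_eq_1) auto

lemma pmf_map_snd_eq_sum:
  fixes Q :: "('x::finite \<times> 'y::finite) pmf"
  shows "pmf (map_pmf snd Q) y = (\<Sum>x\<in>UNIV. pmf Q (x, y))"
proof -
  have "pmf (map_pmf snd Q) y = measure (measure_pmf Q) ((\<lambda>x. (x, y)) ` UNIV)"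
    by (simp add: pmf_map) (rule arg_cong[where f="measure _"], auto)
  also have "\<dots> = (\<Sum>z\<in>(\<lambda>x. (x, y)) ` UNIV. pmf Q z)"
    by (rule measure_measure_pmf_finite) simp
  also have "\<dots> = (\<Sum>x\<in>UNIV. pmf Q (x, y))"
    by (subst sum.reindex) (auto simp: inj_on_def)
  finally show ?thesis .
qed

lemma kl_div_le_ereal_iff:
  fixes P Q :: "'a::finite pmf"
  shows "kl_div Q P \<le> ereal c \<longleftrightarrow>
    (\<forall>x. pmf P x = 0 \<longrightarrow> pmf Q x = 0) \<and> (\<Sum>x\<in>UNIV. pmf Q x * ln (pmf Q x / pmf P x)) \<le> c"
  by (simp add: kl_div_eq_sum)

section \<open>The helper rate and its one-parameter dual\<close>

definition max_prob :: "'a::finite pmf \<Rightarrow> real" where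
  "max_prob p = Max (range (pmf p))"

lemma pmf_le_max_prob: "pmf p x \<le> max_prob p"
  by (simp add: max_prob_def)

lemma ex_max_prob: "\<exists>x. pmf p x = max_prob p"
proof -
  have "max_prob p \<in> range (pmf p)" unfolding max_prob_def by (rule Max_in) auto
  then show ?thesis by auto
qed

lemma max_prob_pos: "0 < max_prob p"
proof -
  obtain x where "x \<in> set_pmf p" using set_pmf_not_empty[of p] by auto
  then have "0 < pmf p x" by (simp add: pmf_positive)
  then show ?thesis using pmf_le_max_prob[of p x] by linarith
qed

lemma power_sum_pos:
  fixes p :: "'a::finite pmf"
  shows "0 < (\<Sum>x\<in>UNIV. pmf p x powr c)"
proof -
  obtain x where "pmf p x = max_prob p" using ex_max_prob by auto
  then have "0 < pmf p x powr c" using max_prob_pos[of p] by simp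
  then show ?thesis by (intro sum_pos2[of _ x]) auto
qed

lemma scaled_log_power_sum_pos:
  "0 < l \<Longrightarrow> scaled_log_power_sum p l = l * ln (\<Sum>x\<in>UNIV. pmf p x powr (1 + 1 / l))"
  by (simp add: scaled_log_power_sum_def)

text \<open>The power sum lies between its largest term and the alphabet size times that term. After
  taking logarithms and multiplying by \<open>t\<close>, the two bounds differ by
  \<open>t * ln n\<close>, which vanishes as \<open>t\<close> tends to 0.\<close>

lemma scaled_log_power_sum_0:
  fixes p :: "'a::finite pmf"
  shows "scaled_log_power_sum p 0 = ln (max_prob p)"
proof -
  define M where "M = max_prob p"
  define n where "n = real CARD('a)"
  have M: "M > 0" and n: "n > 0" by (simp_all add: M_def n_def max_prob_pos)
  have *: "(1 + t) * ln M \<le> t * ln (\<Sum>x\<in>UNIV. pmf p x powr (1 + 1 / t))"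
          "t * ln (\<Sum>x\<in>UNIV. pmf p x powr (1 + 1 / t)) \<le> t * ln n + (1 + t) * ln M"
    if t: "0 < t" for t
  proof -
    obtain x0 where x0: "pmf p x0 = M" using ex_max_prob M_def by auto
    have "M powr (1 + 1 / t) \<le> (\<Sum>x\<in>UNIV. pmf p x powr (1 + 1 / t))"
      using member_le_sum[of x0 UNIV "\<lambda>x. pmf p x powr (1 + 1 / t)"] x0 by simp
    then have "ln (M powr (1 + 1 / t)) \<le> ln (\<Sum>x\<in>UNIV. pmf p x powr (1 + 1 / t))"
      using M power_sum_pos by (subst ln_le_cancel_iff) auto
    then have "t * ((1 + 1 / t) * ln M) \<le> t * ln (\<Sum>x\<in>UNIV. pmf p x powr (1 + 1 / t))"
      using M t by (simp add: ln_powr)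
    moreover have tt: "t * ((1 + 1 / t) * ln M) = (1 + t) * ln M" using t by (simp add: field_simps)
    ultimately show "(1 + t) * ln M \<le> t * ln (\<Sum>x\<in>UNIV. pmf p x powr (1 + 1 / t))" by simp
    have "(\<Sum>x\<in>UNIV. pmf p x powr (1 + 1 / t)) \<le> (\<Sum>x\<in>(UNIV::'a set). M powr (1 + 1 / t))"
      using t by (intro sum_mono powr_mono2) (auto simp: M_def pmf_le_max_prob)
    also have "\<dots> = n * M powr (1 + 1 / t)" by (simp add: n_def)
    finally have "ln (\<Sum>x\<in>UNIV. pmf p x powr (1 + 1 / t)) \<le> ln (n * M powr (1 + 1 / t))"
      using M n power_sum_pos by (subst ln_le_cancel_iff) auto
    also have "\<dots> = ln n + (1 + 1 / t) * ln M" using M n by (simp add: ln_mult_pos ln_powr)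
    finally have "t * ln (\<Sum>x\<in>UNIV. pmf p x powr (1 + 1 / t)) \<le> t * (ln n + (1 + 1 / t) * ln M)"
      using t by simp
    then show "t * ln (\<Sum>x\<in>UNIV. pmf p x powr (1 + 1 / t)) \<le> t * ln n + (1 + t) * ln M"
      using tt by (simp add: distrib_left)
  qed
  have "((\<lambda>t. t * ln (\<Sum>x\<in>UNIV. pmf p x powr (1 + 1 / t))) \<longlongrightarrow> ln M) (at_right 0)"
  proof (rule tendsto_sandwich)
    show "((\<lambda>t. (1 + t) * ln M) \<longlongrightarrow> ln M) (at_right 0)"
      by (auto intro!: tendsto_eq_intros)
    show "((\<lambda>t. t * ln n + (1 + t) * ln M) \<longlongrightarrow> ln M) (at_right 0)"
      by (auto intro!: tendsto_eq_intros)
    show "\<forall>\<^sub>F t in at_right 0. (1 + t) * ln M \<le> t * ln (\<Sum>x\<in>UNIV. pmf p x powr (1 + 1 / t))"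
      using eventually_at_right_less[of 0] by eventually_elim (rule *)
    show "\<forall>\<^sub>F t in at_right 0. t * ln (\<Sum>x\<in>UNIV. pmf p x powr (1 + 1 / t)) \<le> t * ln n + (1 + t) * ln M"
      using eventually_at_right_less[of 0] by eventually_elim (rule *)
  qed
  then show ?thesis
    by (simp add: scaled_log_power_sum_def M_def tendsto_Lim)
qed

text \<open>For positive \<open>l\<close>, adding \<open>l\<close> times the divergence to the
  self-information gives \<open>l\<close> times a divergence from the unnormalised weights
  \<open>p\<close> to the power \<open>1 + 1 / l\<close>, and the log-sum inequality bounds it
  below. For \<open>l = 0\<close>, no symbol is likelier than \<open>max_prob p\<close>.\<close>

lemma self_information_weak_duality:
  fixes p Q :: "'a::finite pmf"
  assumes l: "0 \<le> l" and kl: "kl_div Q p \<le> ereal E0"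
  shows "- scaled_log_power_sum p l - l * E0 \<le> expected_self_information Q p"
proof (cases "l = 0")
  case True
  have "pmf Q x * ln (1 / pmf p x) \<ge> pmf Q x * - ln (max_prob p)" for x
  proof (cases "pmf p x = 0")
    case True
    \<comment> \<open>Here \<open>ln (1 / 0)\<close> evaluates to 0 and could violate the bound;
      absolute continuity rescues it by forcing \<open>pmf Q x = 0\<close>.\<close>
    then show ?thesis using kl by (simp add: kl_div_le_ereal_iff)
  next
    case False
    then have "pmf p x > 0" by (simp add: order_less_le)
    then have "ln (1 / pmf p x) \<ge> - ln (max_prob p)"
      using pmf_le_max_prob[of p x] max_prob_pos[of p] by (simp add: ln_divide_pos)
    then show ?thesis by (intro mult_left_mono) auto
  qed
  then have "(\<Sum>x\<in>UNIV. pmf Q x * - ln (max_prob p)) \<le> expected_self_information Q p"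
    unfolding expected_self_information_eq_sum by (intro sum_mono)
  then show ?thesis using True
    by (simp add: scaled_log_power_sum_0 sum_pmf_UNIV sum_negf flip: sum_distrib_right)
next
  case False
  with l have l: "l > 0" by simp
  have ac: "\<And>x. pmf p x = 0 \<Longrightarrow> pmf Q x = 0"
    and D: "(\<Sum>x\<in>UNIV. pmf Q x * ln (pmf Q x / pmf p x)) \<le> E0"
    using kl by (auto simp: kl_div_le_ereal_iff)
  have "l * (pmf Q x * ln (pmf Q x / pmf p x powr (1 + 1 / l)))
      = l * (pmf Q x * ln (pmf Q x / pmf p x)) + pmf Q x * ln (1 / pmf p x)" for x
  proof (cases "pmf Q x = 0")
    case False
    then have "pmf Q x > 0" "pmf p x > 0" using ac[of x] by (auto simp: order_less_le)
    then show ?thesis using l by (simp add: ln_divide_pos ln_powr field_simps)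
  qed simp
  then have "l * (\<Sum>x\<in>UNIV. pmf Q x * ln (pmf Q x / pmf p x powr (1 + 1 / l)))
    = l * (\<Sum>x\<in>UNIV. pmf Q x * ln (pmf Q x / pmf p x)) + expected_self_information Q p"
    by (simp add: sum_distrib_left expected_self_information_eq_sum sum.distrib)
  moreover have "- ln (\<Sum>x\<in>UNIV. pmf p x powr (1 + 1 / l))
      \<le> (\<Sum>x\<in>UNIV. pmf Q x * ln (pmf Q x / pmf p x powr (1 + 1 / l)))"
    using log_sum_inequality[of UNIV "pmf Q" "\<lambda>x. pmf p x powr (1 + 1 / l)"] ac
      power_sum_pos[of p "1 + 1 / l"]
    by (simp add: sum_pmf_UNIV ln_divide_pos)
  then have "l * - ln (\<Sum>x\<in>UNIV. pmf p x powr (1 + 1 / l))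
      \<le> l * (\<Sum>x\<in>UNIV. pmf Q x * ln (pmf Q x / pmf p x powr (1 + 1 / l)))"
    using l by (intro mult_left_mono) auto
  moreover have "l * (\<Sum>x\<in>UNIV. pmf Q x * ln (pmf Q x / pmf p x)) \<le> l * E0"
    using D l by simp
  ultimately show ?thesis unfolding scaled_log_power_sum_pos[OF l] by linarith
qed

text \<open>A feasible law and a multiplier of equal value certify each other as optimal through
  weak duality, so it suffices to exhibit one such pair.\<close>

lemma self_information_strong_duality:
  fixes p :: "'a::finite pmf"
  assumes E0: "0 < E0"
  shows "\<exists>Q l. 0 \<le> l \<and> kl_div Q p \<le> ereal E0
    \<and> expected_self_information Q p = - scaled_log_power_sum p l - l * E0"
proof -
  define Z where "Z = (\<lambda>s. \<Sum>x\<in>UNIV. pmf p x powr (1 + s))"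
  define q where "q = (\<lambda>s. normalized_pmf (\<lambda>x. pmf p x powr (1 + s)))"
  define D where "D = (\<lambda>s. \<Sum>x\<in>UNIV. pmf (q s) x * ln (pmf (q s) x / pmf p x))"
  have Zpos: "Z s > 0" for s unfolding Z_def by (rule power_sum_pos)
  have q: "pmf (q s) x = pmf p x powr (1 + s) / Z s" for s x
    using Zpos[of s] unfolding q_def Z_def by (intro pmf_normalized_pmf) auto
  show ?thesis
  proof (cases "\<exists>s>0. D s = E0")
    case True
    then obtain s where s: "s > 0" "D s = E0" by auto
    \<comment> \<open>Along the tilted family the log-likelihood ratio is affine in the
      self-information. Summing and solving \<open>D s = E0\<close> for the expected
      self-information yields the multiplier \<open>1 / s\<close>.\<close>
    have "pmf (q s) x * ln (pmf (q s) x / pmf p x)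
        = - s * (pmf (q s) x * ln (1 / pmf p x)) - pmf (q s) x * ln (Z s)" for x
    proof (cases "pmf p x = 0")
      case False
      then have "pmf p x > 0" by (simp add: order_less_le)
      then have "ln (pmf (q s) x / pmf p x) = - s * ln (1 / pmf p x) - ln (Z s)"
        using Zpos[of s] by (simp add: q ln_divide_pos ln_mult_pos ln_powr algebra_simps)
      then show ?thesis by (simp only:) (simp add: algebra_simps)
    qed (simp add: q)
    then have "D s = - s * expected_self_information (q s) p - ln (Z s)"
      by (simp add: D_def expected_self_information_eq_sum sum_subtractf sum_negf sum_pmf_UNIV
          flip: sum_distrib_left sum_distrib_right)
    then have "expected_self_information (q s) p = - (1 / s * ln (Z s)) - 1 / s * E0"
      using s by (simp add: field_simps)
    then have "expected_self_information (q s) p = - scaled_log_power_sum p (1 / s) - 1 / s * E0"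
      using s by (simp add: scaled_log_power_sum_pos Z_def)
    moreover have "kl_div (q s) p \<le> ereal E0"
      using s by (simp add: kl_div_le_ereal_iff D_def q)
    ultimately show ?thesis using s by (intro exI[of _ "q s"] exI[of _ "1 / s"]) auto
  next
    case False
    have D0: "D 0 = 0"
      using sum_pmf_UNIV[of p] by (auto simp: D_def q Z_def intro!: sum.neutral)
    have cont: "continuous_on {0..} D"
      unfolding D_def
    proof (intro continuous_on_sum)
      fix x
      show "continuous_on {0..} (\<lambda>s. pmf (q s) x * ln (pmf (q s) x / pmf p x))"
      proof (cases "pmf p x = 0")
        case False
        then have "pmf p x > 0" by (simp add: order_less_le)
        moreover have "continuous_on {0..} Z"
          unfolding Z_def
        proof (intro continuous_on_sum)
          fix x
          show "continuous_on {0..} (\<lambda>s. pmf p x powr (1 + s))"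
            by (cases "pmf p x = 0") (auto intro!: continuous_intros)
        qed
        ultimately show ?thesis
          using Zpos unfolding q by (intro continuous_intros) (auto simp: less_imp_neq[symmetric])
      qed simp
    qed
    \<comment> \<open>\<open>D\<close> is continuous, starts at 0 below \<open>E0\<close> and never
      meets \<open>E0\<close>, so it cannot cross it.\<close>
    have Dle: "D s \<le> E0" if "s \<ge> 0" for s
    proof (rule ccontr)
      assume "\<not> D s \<le> E0"
      then have "\<exists>x\<ge>0. x \<le> s \<and> D x = E0"
        using E0 D0 that by (intro IVT' continuous_on_subset[OF cont]) auto
      then show False using False D0 E0 by (metis order_le_less less_irrefl)
    qed
    define M where "M = max_prob p"
    have M: "M > 0" by (simp add: M_def max_prob_pos)
    \<comment> \<open>Indicator of the most likely symbols: the pointwise limit of the rescaled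
      tilted weights as \<open>s\<close> grows.\<close>
    define w where "w = (\<lambda>x. of_bool (pmf p x = M) :: real)"
    define Q where "Q = normalized_pmf w"
    obtain x0 where x0: "pmf p x0 = M" using ex_max_prob M_def by auto
    have W: "sum w UNIV > 0"
      using x0 by (intro sum_pos2[of _ x0]) (auto simp: w_def)
    have Q: "pmf Q x = w x / sum w UNIV" for x
      using W unfolding Q_def by (intro pmf_normalized_pmf) (auto simp: w_def)
    have lim_w: "((\<lambda>s. (pmf p x / M) powr (1 + s)) \<longlongrightarrow> w x) at_top" for x
    proof -
      consider "pmf p x = M" | "pmf p x = 0" "M \<noteq> 0" | "0 < pmf p x / M" "pmf p x / M < 1"
        using M pmf_le_max_prob[of p x] by (force simp: M_def order_less_le)
      then show ?thesis
      proof cases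
        case 3
        have "((\<lambda>s. r powr (1 + s)) \<longlongrightarrow> 0) at_top" if "0 < r" "r < 1" for r :: real
          using that by real_asymp
        from this[OF 3] have "((\<lambda>s. (pmf p x / M) powr (1 + s)) \<longlongrightarrow> 0) at_top" .
        then show ?thesis using 3 M by (auto simp: w_def)
      qed (use M in \<open>auto simp: w_def\<close>)
    qed
    \<comment> \<open>Scaling by \<open>M\<close> keeps the normaliser away from 0: it tends to the
      number of most likely symbols, whereas \<open>Z s\<close> itself may vanish in the
      limit.\<close>
    have q': "pmf (q s) x = (pmf p x / M) powr (1 + s) / (\<Sum>x\<in>UNIV. (pmf p x / M) powr (1 + s))" for s x
      using M by (simp add: q Z_def powr_divide flip: sum_divide_distrib)
    have lim_q: "((\<lambda>s. pmf (q s) x) \<longlongrightarrow> pmf Q x) at_top" for x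
      unfolding q' Q using W by (intro tendsto_divide lim_w tendsto_sum) auto
    \<comment> \<open>The logarithm of the ratio diverges where the limit law vanishes; splitting
      isolates \<open>t * ln t\<close>, which stays continuous at 0.\<close>
    have split: "t * ln (t / c) = t * ln t - t * ln c" if "c > 0" "t \<ge> 0" for t c :: real
      using that by (cases "t = 0") (auto simp: ln_divide_pos algebra_simps)
    have "(D \<longlongrightarrow> (\<Sum>x\<in>UNIV. pmf Q x * ln (pmf Q x / pmf p x))) at_top"
      unfolding D_def
    proof (intro tendsto_sum)
      fix x
      show "((\<lambda>s. pmf (q s) x * ln (pmf (q s) x / pmf p x)) \<longlongrightarrow> pmf Q x * ln (pmf Q x / pmf p x)) at_top"
      proof (cases "pmf p x = 0")
        case False
        then have "pmf p x > 0" by (simp add: order_less_le)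
        moreover have "((\<lambda>s. pmf (q s) x * ln (pmf (q s) x)) \<longlongrightarrow> pmf Q x * ln (pmf Q x)) at_top"
          by (rule continuous_on_tendsto_compose[OF continuous_on_mult_ln lim_q]) auto
        ultimately show ?thesis by (simp add: split lim_q tendsto_intros)
      qed simp
    qed
    then have "(\<Sum>x\<in>UNIV. pmf Q x * ln (pmf Q x / pmf p x)) \<le> E0"
      by (rule tendsto_upperbound) (auto intro!: eventually_at_top_linorderI Dle)
    then have "kl_div Q p \<le> ereal E0"
      using M by (simp add: kl_div_le_ereal_iff Q w_def)
    \<comment> \<open>\<open>Q\<close> charges only symbols of probability \<open>M\<close>, so its
      self-information is the dual value at multiplier 0.\<close>
    moreover have "pmf Q x * ln (1 / pmf p x) = pmf Q x * - ln M" for x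
      using M by (simp add: Q w_def ln_divide_pos)
    then have "expected_self_information Q p = - scaled_log_power_sum p 0 - 0 * E0"
      by (simp add: expected_self_information_eq_sum scaled_log_power_sum_0 M_def sum_negf sum_pmf_UNIV
          flip: sum_distrib_right)
    ultimately show ?thesis by blast
  qed
qed

section \<open>The divergence minus \<rho> times the conditional entropy\<close>

text \<open>The sum in Gallager's exponent for source coding with side information at the
  decoder.\<close>

definition gallager_sum :: "('x::finite \<times> 'y::finite) pmf \<Rightarrow> real \<Rightarrow> real" where
  "gallager_sum P \<rho> = (\<Sum>y\<in>UNIV. (\<Sum>x\<in>UNIV. pmf P (x, y) powr (1 / (1 + \<rho>))) powr (1 + \<rho>))"

lemma gallager_sum_pos: "0 < gallager_sum P \<rho>"
proof -
  obtain x y where "(x, y) \<in> set_pmf P" using set_pmf_not_empty[of P] by auto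
  then have "0 < pmf P (x, y)" by (simp add: pmf_positive)
  then have "0 < (\<Sum>x\<in>UNIV. pmf P (x, y) powr (1 / (1 + \<rho>)))"
    by (intro sum_pos2[of _ x]) auto
  then show ?thesis unfolding gallager_sum_def
    by (intro sum_pos2[of _ y]) auto
qed

text \<open>The log-sum inequality is applied twice: over \<open>x\<close> for each fixed
  \<open>y\<close>, then over \<open>y\<close> to the resulting marginal expression.\<close>

lemma gallager_weak_duality:
  fixes P Q :: "('x::finite \<times> 'y::finite) pmf"
  assumes \<rho>: "0 \<le> \<rho>" and ac: "\<And>z. pmf P z = 0 \<Longrightarrow> pmf Q z = 0"
  shows "- ln (gallager_sum P \<rho>)
    \<le> (\<Sum>z\<in>UNIV. pmf Q z * ln (pmf Q z / pmf P z)) - \<rho> * cond_entropy_nats Q"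
proof -
  define S where "S = (\<lambda>y. \<Sum>x\<in>UNIV. pmf P (x, y) powr (1 / (1 + \<rho>)))"
  define m where "m = (\<lambda>y. \<Sum>x\<in>UNIV. pmf Q (x, y))"
  have m0: "m y \<ge> 0" for y by (simp add: m_def sum_nonneg)
  have S0: "S y \<ge> 0" for y by (simp add: S_def sum_nonneg)
  have Sm: "m y = 0" if "S y = 0" for y
  proof -
    have "\<And>x. pmf P (x, y) = 0" using that unfolding S_def by (simp add: sum_nonneg_eq_0_iff)
    then show ?thesis using ac by (simp add: m_def)
  qed
  have summ: "sum m UNIV = 1"
    using sum_pmf_UNIV[of Q] unfolding m_def by (subst sum.swap) (simp add: sum.cartesian_product)
  have m_pos: "m y > 0" if "pmf Q (x, y) > 0" for x y
    using that unfolding m_def by (intro sum_pos2[of _ x]) auto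
  \<comment> \<open>Merging the logarithms gives \<open>1 + \<rho>\<close> copies of
    \<open>ln (pmf Q (x, y))\<close>, hence the power \<open>1 / (1 + \<rho>)\<close> on
    \<open>P\<close>; the marginal splits off.\<close>
  have pt: "pmf Q (x, y) * ln (pmf Q (x, y) / pmf P (x, y)) + \<rho> * (pmf Q (x, y) * ln (pmf Q (x, y) / m y))
     = (1 + \<rho>) * (pmf Q (x, y) * ln (pmf Q (x, y) / pmf P (x, y) powr (1 / (1 + \<rho>))))
       - \<rho> * (pmf Q (x, y) * ln (m y))" for x y
  proof (cases "pmf Q (x, y) = 0")
    case False
    then have "pmf Q (x, y) > 0" "pmf P (x, y) > 0" using ac[of "(x, y)"] by (auto simp: order_less_le)
    then show ?thesis using \<rho> m_pos by (simp add: ln_divide_pos ln_powr field_simps)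
  qed simp
  have "(\<Sum>z\<in>UNIV. pmf Q z * ln (pmf Q z / pmf P z)) - \<rho> * cond_entropy_nats Q
    = (\<Sum>y\<in>UNIV. \<Sum>x\<in>UNIV. pmf Q (x, y) * ln (pmf Q (x, y) / pmf P (x, y))
        + \<rho> * (pmf Q (x, y) * ln (pmf Q (x, y) / m y)))"
    by (subst sum.swap) (simp add: cond_entropy_nats_eq_sum pmf_map_snd_eq_sum m_def sum.distrib
        sum_distrib_left sum.cartesian_product case_prod_unfold)
  also have "\<dots> = (\<Sum>y\<in>UNIV. (1 + \<rho>) * (\<Sum>x\<in>UNIV. pmf Q (x, y) * ln (pmf Q (x, y) / pmf P (x, y) powr (1 / (1 + \<rho>))))
       - \<rho> * (m y * ln (m y)))"
    unfolding pt by (simp add: sum_subtractf m_def sum_distrib_right flip: sum_distrib_left)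
  also have "\<dots> \<ge> (\<Sum>y\<in>UNIV. (1 + \<rho>) * (m y * ln (m y / S y)) - \<rho> * (m y * ln (m y)))"
  proof (intro sum_mono diff_right_mono mult_left_mono)
    fix y
    show "m y * ln (m y / S y)
      \<le> (\<Sum>x\<in>UNIV. pmf Q (x, y) * ln (pmf Q (x, y) / pmf P (x, y) powr (1 / (1 + \<rho>))))"
      unfolding m_def S_def using ac by (intro log_sum_inequality) auto
  qed (use \<rho> in simp)
  \<comment> \<open>The powers of \<open>m y\<close> combine to a single one, putting the expression
    in the form of the second log-sum inequality.\<close>
  also have "(\<Sum>y\<in>UNIV. (1 + \<rho>) * (m y * ln (m y / S y)) - \<rho> * (m y * ln (m y)))
    = (\<Sum>y\<in>UNIV. m y * ln (m y / S y powr (1 + \<rho>)))"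
  proof (intro sum.cong refl)
    fix y
    show "(1 + \<rho>) * (m y * ln (m y / S y)) - \<rho> * (m y * ln (m y)) = m y * ln (m y / S y powr (1 + \<rho>))"
    proof (cases "m y = 0")
      case False
      then have "m y > 0" "S y > 0" using m0[of y] S0[of y] Sm[of y] by (auto simp: order_less_le)
      then show ?thesis by (simp add: ln_divide_pos ln_powr algebra_simps)
    qed simp
  qed
  also have "\<dots> \<ge> - ln (gallager_sum P \<rho>)"
    using log_sum_inequality[of UNIV m "\<lambda>y. S y powr (1 + \<rho>)"] m0 Sm gallager_sum_pos[of P \<rho>]
    by (simp add: summ gallager_sum_def S_def ln_divide_pos)
  finally show ?thesis .
qed

text \<open>Both log-sum inequalities are tight when the conditional law of \<open>x\<close> given
  \<open>y\<close> is proportional to \<open>P\<close> to the power \<open>1 / (1 + \<rho>)\<close>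
  and the marginal to \<open>S\<close> to the power \<open>1 + \<rho>\<close>. A whole family is
  produced at once because its continuity in \<rho> feeds the intermediate value theorem.\<close>

lemma gallager_attained:
  fixes P :: "('x::finite \<times> 'y::finite) pmf"
  shows "\<exists>Q. (\<forall>\<rho>\<in>{0..}. \<forall>z. pmf P z = 0 \<longrightarrow> pmf (Q \<rho>) z = 0)
    \<and> (\<forall>\<rho>\<in>{0..}. (\<Sum>z\<in>UNIV. pmf (Q \<rho>) z * ln (pmf (Q \<rho>) z / pmf P z)) - \<rho> * cond_entropy_nats (Q \<rho>)
        = - ln (gallager_sum P \<rho>))
    \<and> continuous_on {0..} (\<lambda>\<rho>. cond_entropy_nats (Q \<rho>))"
proof -
  define S where "S = (\<lambda>\<rho> y. \<Sum>x\<in>UNIV. pmf P (x, y) powr (1 / (1 + \<rho>)))"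
  define G where "G = (\<lambda>\<rho>. gallager_sum P \<rho>)"
  \<comment> \<open>Product of the conditional, with denominator \<open>S\<close>, and the marginal
    weight \<open>S powr (1 + \<rho>)\<close>; one power of \<open>S\<close> cancels.\<close>
  define w where "w = (\<lambda>\<rho> z. pmf P z powr (1 / (1 + \<rho>)) * S \<rho> (snd z) powr \<rho>)"
  define Q where "Q = (\<lambda>\<rho>. normalized_pmf (w \<rho>))"
  have S0: "S \<rho> y \<ge> 0" for \<rho> y by (simp add: S_def sum_nonneg)
  have Spos: "S \<rho> y > 0" if "pmf P (x, y) > 0" for \<rho> x y
    using that unfolding S_def by (intro sum_pos2[of _ x]) auto
  have Gpos: "G \<rho> > 0" for \<rho> by (simp add: G_def gallager_sum_pos)
  have wy: "(\<Sum>x\<in>UNIV. w \<rho> (x, y)) = S \<rho> y powr (1 + \<rho>)" for \<rho> y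
    using S0[of \<rho> y] by (simp add: w_def powr_add S_def flip: sum_distrib_right)
  have sw: "sum (w \<rho>) UNIV = G \<rho>" for \<rho>
  proof -
    have "sum (w \<rho>) UNIV = (\<Sum>y\<in>UNIV. \<Sum>x\<in>UNIV. w \<rho> (x, y))"
      by (subst sum.swap) (simp add: sum.cartesian_product)
    then show ?thesis by (simp add: wy G_def gallager_sum_def S_def)
  qed
  have Q: "pmf (Q \<rho>) z = w \<rho> z / G \<rho>" for \<rho> z
    using Gpos[of \<rho>] unfolding Q_def sw[symmetric] by (intro pmf_normalized_pmf) (auto simp: w_def)
  have Qy: "pmf (map_pmf snd (Q \<rho>)) y = S \<rho> y powr (1 + \<rho>) / G \<rho>" for \<rho> y
    by (simp add: pmf_map_snd_eq_sum Q wy flip: sum_divide_distrib)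
  have H: "cond_entropy_nats (Q \<rho>) = - (\<Sum>(x, y)\<in>UNIV. pmf (Q \<rho>) (x, y) *
      ln (pmf P (x, y) powr (1 / (1 + \<rho>)) / S \<rho> y))" for \<rho>
  proof -
    have "pmf (Q \<rho>) (x, y) * ln (pmf (Q \<rho>) (x, y) / pmf (map_pmf snd (Q \<rho>)) y)
      = pmf (Q \<rho>) (x, y) * ln (pmf P (x, y) powr (1 / (1 + \<rho>)) / S \<rho> y)" for x y
    proof (cases "pmf P (x, y) = 0")
      case False
      then have "pmf P (x, y) > 0" by (simp add: order_less_le)
      then show ?thesis using Spos[of x y \<rho>] Gpos[of \<rho>]
        by (simp add: Q Qy w_def powr_add)
    qed (simp add: Q w_def)
    then show ?thesis unfolding cond_entropy_nats_eq_sum by (simp only: case_prod_unfold)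
  qed
  have 1: "pmf (Q \<rho>) z = 0" if "pmf P z = 0" for \<rho> z
    using that by (simp add: Q w_def)
  have 2: "(\<Sum>z\<in>UNIV. pmf (Q \<rho>) z * ln (pmf (Q \<rho>) z / pmf P z)) - \<rho> * cond_entropy_nats (Q \<rho>)
        = - ln (G \<rho>)" if \<rho>: "\<rho> \<ge> 0" for \<rho>
  proof -
    \<comment> \<open>All powers of \<open>S\<close> cancel and the exponent of \<open>P\<close> is
      \<open>(1 + \<rho>) / (1 + \<rho>) - 1 = 0\<close>, leaving only the normaliser.\<close>
    have pt: "pmf (Q \<rho>) (x, y) * ln (pmf (Q \<rho>) (x, y) / pmf P (x, y))
        + \<rho> * (pmf (Q \<rho>) (x, y) * ln (pmf P (x, y) powr (1 / (1 + \<rho>)) / S \<rho> y))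
      = pmf (Q \<rho>) (x, y) * - ln (G \<rho>)" for x y
    proof (cases "pmf P (x, y) = 0")
      case False
      then have p: "pmf P (x, y) > 0" by (simp add: order_less_le)
      have "ln (pmf (Q \<rho>) (x, y) / pmf P (x, y))
        + \<rho> * ln (pmf P (x, y) powr (1 / (1 + \<rho>)) / S \<rho> y) = - ln (G \<rho>)"
      proof -
        define e where "e = 1 / (1 + \<rho>)"
        have "ln (pmf (Q \<rho>) (x, y) / pmf P (x, y)) + \<rho> * ln (pmf P (x, y) powr e / S \<rho> y)
          = (e * (1 + \<rho>) - 1) * ln (pmf P (x, y)) - ln (G \<rho>)"
          using p Spos[OF p, of \<rho>] Gpos[of \<rho>]
          by (simp add: Q w_def ln_divide_pos ln_mult_pos ln_powr algebra_simps flip: e_def)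
        moreover have "e * (1 + \<rho>) = 1" using \<rho> by (simp add: e_def)
        ultimately show ?thesis unfolding e_def by simp
      qed
      then show ?thesis by (metis distrib_left mult.left_commute)
    qed (simp add: Q w_def)
    have "(\<Sum>z\<in>UNIV. pmf (Q \<rho>) z * ln (pmf (Q \<rho>) z / pmf P z)) - \<rho> * cond_entropy_nats (Q \<rho>)
      = (\<Sum>(x, y)\<in>UNIV. pmf (Q \<rho>) (x, y) * - ln (G \<rho>))"
      unfolding H pt[symmetric] by (simp add: case_prod_unfold sum.distrib sum_distrib_left)
    also have "\<dots> = - ln (G \<rho>)"
      by (simp add: case_prod_unfold sum_negf sum_pmf_UNIV flip: sum_distrib_right)
    finally show ?thesis .
  qed
  have contp: "continuous_on {0..} (\<lambda>\<rho>. pmf P z powr (1 / (1 + \<rho>)))" for z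
    by (cases "pmf P z = 0") (auto intro!: continuous_intros)
  have contS: "continuous_on {0..} (\<lambda>\<rho>. S \<rho> y)" for y
    unfolding S_def by (intro continuous_on_sum contp)
  have G_eq: "G = (\<lambda>\<rho>. \<Sum>y\<in>UNIV. S \<rho> y powr (1 + \<rho>))"
    by (simp add: G_def gallager_sum_def S_def)
  have contG: "continuous_on {0..} G"
    unfolding G_eq
  proof (intro continuous_on_sum)
    fix y
    show "continuous_on {0..} (\<lambda>\<rho>. S \<rho> y powr (1 + \<rho>))"
    \<comment> \<open>A column of \<open>P\<close> that is entirely zero makes the function
      constantly 0; otherwise the base is positive for every \<rho>.\<close>
    proof (cases "\<exists>x. pmf P (x, y) \<noteq> 0")
      case True
      then obtain x where "pmf P (x, y) > 0" by (auto simp: order_less_le)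
      then have "S \<rho> y > 0" for \<rho> by (rule Spos)
      then show ?thesis by (intro continuous_intros contS) (auto simp: less_imp_neq[symmetric])
    qed (simp add: S_def)
  qed
  have "continuous_on {0..} (\<lambda>\<rho>. cond_entropy_nats (Q \<rho>))"
    unfolding H
  proof (intro continuous_on_minus continuous_on_sum)
    fix z :: "'x \<times> 'y"
    obtain x y where z: "z = (x, y)" by fastforce
    have "continuous_on {0..} (\<lambda>\<rho>. pmf (Q \<rho>) (x, y) * ln (pmf P (x, y) powr (1 / (1 + \<rho>)) / S \<rho> y))"
    proof (cases "pmf P (x, y) = 0")
      case False
      then have "pmf P (x, y) > 0" by (simp add: order_less_le)
      then have "S \<rho> y \<noteq> 0" for \<rho> using Spos[of x y \<rho>] by simp
      moreover have "G \<rho> \<noteq> 0" for \<rho> using Gpos[of \<rho>] by simp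
      ultimately show ?thesis using False unfolding Q w_def snd_conv
        by (intro continuous_intros contp contS contG) auto
    qed (simp add: Q w_def)
    then show "continuous_on {0..} (\<lambda>\<rho>. case z of (x, y) \<Rightarrow>
        pmf (Q \<rho>) (x, y) * ln (pmf P (x, y) powr (1 / (1 + \<rho>)) / S \<rho> y))"
      by (simp add: z)
  qed
  with 1 2 show ?thesis unfolding G_def by (intro exI[of _ Q]) auto
qed

section \<open>The saddle point\<close>

text \<open>The definitions use infima and suprema; the three existence claims assert that the two
  minima and the maximum over \<rho> are attained.\<close>

theorem mainTheorem4:
  fixes P :: "('x::finite \<times> 'y::finite) pmf" and E0 :: real
  assumes "0 < E0"
  shows "(\<exists>Q. is_arg_min (\<lambda>Q. expected_self_information Q (map_pmf fst P))
                (\<lambda>Q. kl_div Q (map_pmf fst P) \<le> ereal E0) Q)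
    \<and> (\<exists>Q. is_arg_min (fr_objective P E0) (\<lambda>Q. True) Q)
    \<and> (\<exists>\<rho>. is_arg_max (dual_value P E0) (\<lambda>\<rho>. \<rho> \<in> {0..1}) \<rho>)
    \<and> fr_exponent P E0 = (SUP \<rho>\<in>{0..1}. dual_value P E0 \<rho>)"
proof -
  define p where "p = map_pmf fst P"
  define R where "R = helper_rate P E0"
  obtain Qw lw where lw: "0 \<le> lw" and Qw: "kl_div Qw p \<le> ereal E0"
    and eq: "expected_self_information Qw p = - scaled_log_power_sum p lw - lw * E0"
    using self_information_strong_duality[OF assms] by blast
  have Qw_min: "expected_self_information Qw p \<le> expected_self_information Q p"
    if "kl_div Q p \<le> ereal E0" for Q
    using self_information_weak_duality[OF lw that] eq by simp
  \<comment> \<open>A real infimum is meaningful only for a nonempty set bounded below; the explicit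
    minimiser settles both.\<close>
  have "(INF Q\<in>{Q. kl_div Q p \<le> ereal E0}. expected_self_information Q p) = expected_self_information Qw p"
    by (rule cInf_eq_minimum) (use Qw Qw_min in auto)
  then have R: "R = expected_self_information Qw p - E0"
    by (simp add: R_def helper_rate_def p_def)
  \<comment> \<open>The supremum over \<open>l\<close> is reached at \<open>lw\<close> whatever
    \<rho> is, since \<rho> only scales the part depending on \<open>l\<close>; that part becomes
    \<open>R\<close>.\<close>
  have dual: "dual_value P E0 \<rho> = ereal (- ln (gallager_sum P \<rho>) + \<rho> * R)" if "\<rho> \<ge> 0" for \<rho>
  proof -
    have obj: "dual_objective P E0 \<rho> l
      = - ln (gallager_sum P \<rho>) + \<rho> * ((- scaled_log_power_sum p l - l * E0) - E0)" for l
      by (simp add: dual_objective_def gallager_sum_def p_def algebra_simps)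
    have "dual_objective P E0 \<rho> l \<le> - ln (gallager_sum P \<rho>) + \<rho> * R" if "l \<ge> 0" for l
      unfolding obj R using self_information_weak_duality[OF that Qw] \<open>\<rho> \<ge> 0\<close>
      by (intro add_left_mono mult_left_mono) auto
    moreover have "dual_objective P E0 \<rho> lw = - ln (gallager_sum P \<rho>) + \<rho> * R"
      unfolding obj R eq by simp
    ultimately show ?thesis unfolding dual_value_def
      using lw by (intro SUP_eqI) (auto, metis atLeast_iff)
  qed
  \<comment> \<open>For \<rho> between 0 and 1, multiplying a gap by \<rho> never exceeds its
    positive part. Without absolute continuity the objective is infinite.\<close>
  have weak: "dual_value P E0 \<rho> \<le> fr_objective P E0 Q" if \<rho>: "\<rho> \<in> {0..1}" for \<rho> Q
  proof (cases "\<forall>z. pmf P z = 0 \<longrightarrow> pmf Q z = 0")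
    case True
    have "\<rho> * (R - cond_entropy_nats Q) \<le> \<rho> * max 0 (R - cond_entropy_nats Q)"
      using \<rho> by (intro mult_left_mono) auto
    also have "\<dots> \<le> 1 * max 0 (R - cond_entropy_nats Q)"
      using \<rho> by (intro mult_right_mono) auto
    finally have "- ln (gallager_sum P \<rho>) + \<rho> * R
        \<le> (\<Sum>z\<in>UNIV. pmf Q z * ln (pmf Q z / pmf P z)) + max 0 (R - cond_entropy_nats Q)"
      using gallager_weak_duality[of \<rho> P Q] \<rho> True by (simp add: algebra_simps)
    then show ?thesis using True \<rho> by (simp add: dual fr_objective_def kl_div_eq_sum R_def del: ereal_max)
  next
    case False
    then show ?thesis by (auto simp: fr_objective_def kl_div_eq_sum)
  qed
  obtain Q where Qac: "\<And>\<rho> z. \<rho> \<ge> 0 \<Longrightarrow> pmf P z = 0 \<Longrightarrow> pmf (Q \<rho>) z = 0"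
    and Qeq: "\<And>\<rho>. \<rho> \<ge> 0 \<Longrightarrow> (\<Sum>z\<in>UNIV. pmf (Q \<rho>) z * ln (pmf (Q \<rho>) z / pmf P z))
        - \<rho> * cond_entropy_nats (Q \<rho>) = - ln (gallager_sum P \<rho>)"
    and Qcont: "continuous_on {0..} (\<lambda>\<rho>. cond_entropy_nats (Q \<rho>))"
    using gallager_attained[of P] by (auto simp: Ball_def)
  define h where "h = (\<lambda>\<rho>. R - cond_entropy_nats (Q \<rho>))"
  \<comment> \<open>A nonpositive gap at 0 allows \<rho> = 0, a nonnegative gap at 1 allows \<rho> =
    1, and otherwise \<open>h\<close> has a zero in between.\<close>
  have "\<exists>\<rho>\<in>{0..1}. max 0 (h \<rho>) = \<rho> * h \<rho>"
  proof -
    consider "h 0 \<le> 0" | "h 1 \<ge> 0" | "h 1 \<le> 0" "0 \<le> h 0" by linarith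
    then show ?thesis
    proof cases
      case 3
      have "continuous_on {0..1} h"
        unfolding h_def by (intro continuous_intros continuous_on_subset[OF Qcont]) auto
      then obtain \<rho> where "0 \<le> \<rho>" "\<rho> \<le> 1" "h \<rho> = 0"
        using IVT2'[of h 1 0 0] 3 by auto
      then show ?thesis by (intro bexI[of _ \<rho>]) auto
    qed (auto intro: bexI[of _ 0] bexI[of _ 1])
  qed
  then obtain \<rho> where \<rho>: "\<rho> \<in> {0..1}" and h: "max 0 (h \<rho>) = \<rho> * h \<rho>" by blast
  \<comment> \<open>Complementarity replaces the positive part by \<open>\<rho> * h \<rho>\<close>,
    making the objective exactly the functional that \<open>Q \<rho>\<close> minimises, shifted by
    \<open>\<rho> * R\<close>.\<close>
  have strong: "fr_objective P E0 (Q \<rho>) = dual_value P E0 \<rho>"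
    using Qac[of \<rho>] Qeq[of \<rho>] \<rho> h
    by (simp add: dual fr_objective_def kl_div_eq_sum R_def h_def algebra_simps del: ereal_max)
  have "is_arg_min (\<lambda>Q. expected_self_information Q p) (\<lambda>Q. kl_div Q p \<le> ereal E0) Qw"
    using Qw Qw_min by (auto simp: is_arg_min_def not_less)
  \<comment> \<open>Every dual value is below every primal value, so the pair where they agree is
    optimal on both sides.\<close>
  moreover have "is_arg_min (fr_objective P E0) (\<lambda>Q. True) (Q \<rho>)"
    using weak[OF \<rho>] strong by (auto simp: is_arg_min_def not_less)
  moreover have "is_arg_max (dual_value P E0) (\<lambda>\<rho>. \<rho> \<in> {0..1}) \<rho>"
    using \<rho> weak[of _ "Q \<rho>"] strong by (auto simp: is_arg_max_def not_less)
  moreover have "fr_exponent P E0 = fr_objective P E0 (Q \<rho>)"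
    unfolding fr_exponent_def using weak[OF \<rho>] strong by (intro INF_eqI) (simp, metis UNIV_I)
  moreover have "(SUP \<rho>\<in>{0..1}. dual_value P E0 \<rho>) = fr_objective P E0 (Q \<rho>)"
    using \<rho> weak[of _ "Q \<rho>"] strong by (intro SUP_eqI) auto
  ultimately show ?thesis unfolding p_def by auto
qed

end
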